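(* Let $F=f+h$ be as in the context. Then the sequence of iterates $\{x_k\}_{k\ge0}$ generated by the algorithm CUESA (described in the context), from any initial point $x_0\in\mathbb{R}^n$, exhibits a linear rate of convergence: for all $k\ge 0$, $$F(x_k)-\varphi_k^*\le\left(1-\tfrac{\mu}{L}\right)^k\,(F(x_0)-\varphi_0^* ).$$
   Context: Setting: $F:=f+h$ on $\mathbb{R}^n$ (Euclidean norm), where $h:\mathbb{R}^n\to\mathbb{R}$ is convex (possibly nonsmooth) and $f:\mathbb{R}^n\to\mathbb{R}$ is continuously differentiable, $\mu$-strongly convex and $L$-smooth with $L\ge\mu>0$, i.e. for all $x,y\in\mathbb{R}^n$: $f(x)\ge f(y)+\langle\nabla f(y),x-y\rangle+\frac{\mu}{2}\|x-y\|^2$ and $f(x)\le f(y)+\langle\nabla f(y),x-y\rangle+\frac{L}{2}\|x-y\|^2$. Proximal gradient: $\mathrm{prox}_{h,L}(x):=\arg\min_u\{h(u)+\frac{L}{2}\|x-u\|^2\}$, $G_L(x):=L\left(x-\mathrm{prox}_{h,L}(x-\frac1L\nabla f(x))\right)$. For a point $x$: $x^+:=x-\frac1L G_L(x)$ and $x^{++}:=x-\frac1\mu G_L(x)$. Algorithm CUESA (run without its stopping test $F(x_k)-\varphi_k^*\le\epsilon$, so that infinite sequences are produced): given $x_0$, set $\alpha_k=\mu/L$ for all $k\ge0$, $v_0=x_0^{++}$ and $\varphi_0^*=F(x_0^+)+\left(\frac1{2L}-\frac1{2\mu}\right)\|G_L(x_0)\|^2$. For $k=0,1,2,\dots$: set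 $y_k=x_k$; $x_{k+1}=x_k-\frac1L G_L(x_k)$; $v_{k+1}=(1-\alpha_k)v_k+\alpha_k y_k^{++}$; and $$\varphi_{k+1}^*=(1-\alpha_k)\left(\varphi_k^*+\tfrac{\mu}{2}\|v_{k+1}-v_k\|^2\right)+\alpha_k\left(F(y_k^+)+\left(\tfrac1{2L}-\tfrac1{2\mu}\right)\|G_L(y_k)\|^2+\tfrac{\mu}{2}\|v_{k+1}-y_k^{++}\|^2\right).$$ *)

theory Defs
  imports "HOL-Analysis.Analysis"
begin

text \<open>
  Throughout, \<open>df\<close> stands for the gradient of the smooth part \<open>f\<close> of \<open>F = f + h\<close>.
\<close>

text \<open>
  The argmin is taken over the whole space. \<^const>\<open>arg_min\<close> picks some minimizer; for convex \<open>h\<close>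
  and \<open>L > 0\<close> the objective is strongly convex and continuous, so the minimizer exists and is unique.
\<close>

definition prox :: "(real ^ 'n \<Rightarrow> real) \<Rightarrow> real \<Rightarrow> real ^ 'n \<Rightarrow> real ^ 'n" where
  "prox h L x = arg_min (\<lambda>u. h u + L / 2 * (norm (x - u))\<^sup>2) (\<lambda>_. True)"

definition grad_map ::
  "(real ^ 'n \<Rightarrow> real ^ 'n) \<Rightarrow> (real ^ 'n \<Rightarrow> real) \<Rightarrow> real \<Rightarrow> real ^ 'n \<Rightarrow> real ^ 'n" where
  "grad_map df h L x = L *\<^sub>R (x - prox h L (x - (1 / L) *\<^sub>R df x))"

text \<open>
  The points \<open>x\<^sup>+\<close> and \<open>x\<^sup>+\<^sup>+\<close>; both use the map with parameter \<open>L\<close>,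
  only the step length differs.
\<close>

definition short_step ::
  "(real ^ 'n \<Rightarrow> real ^ 'n) \<Rightarrow> (real ^ 'n \<Rightarrow> real) \<Rightarrow> real \<Rightarrow> real ^ 'n \<Rightarrow> real ^ 'n" where
  "short_step df h L x = x - (1 / L) *\<^sub>R grad_map df h L x"

definition long_step ::
  "(real ^ 'n \<Rightarrow> real ^ 'n) \<Rightarrow> (real ^ 'n \<Rightarrow> real) \<Rightarrow> real \<Rightarrow> real \<Rightarrow> real ^ 'n \<Rightarrow> real ^ 'n" where
  "long_step df h \<mu> L x = x - (1 / \<mu>) *\<^sub>R grad_map df h L x"

text \<open>
  The sequences \<open>\<alpha>\<^sub>k\<close>, \<open>x\<^sub>k\<close>, \<open>y\<^sub>k\<close>, \<open>v\<^sub>k\<close>, \<open>\<phi>\<^sub>k\<^sup>*\<close> produced by CUESA when it is run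
  without its stopping test.
\<close>

definition cuesa_alpha :: "real \<Rightarrow> real \<Rightarrow> nat \<Rightarrow> real" where
  "cuesa_alpha \<mu> L k = \<mu> / L"

primrec cuesa_x ::
  "(real ^ 'n \<Rightarrow> real ^ 'n) \<Rightarrow> (real ^ 'n \<Rightarrow> real) \<Rightarrow> real \<Rightarrow> real ^ 'n \<Rightarrow> nat \<Rightarrow> real ^ 'n" where
  "cuesa_x df h L x0 0 = x0"
| "cuesa_x df h L x0 (Suc k) =
     cuesa_x df h L x0 k - (1 / L) *\<^sub>R grad_map df h L (cuesa_x df h L x0 k)"

definition cuesa_y ::
  "(real ^ 'n \<Rightarrow> real ^ 'n) \<Rightarrow> (real ^ 'n \<Rightarrow> real) \<Rightarrow> real \<Rightarrow> real ^ 'n \<Rightarrow> nat \<Rightarrow> real ^ 'n" where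
  "cuesa_y df h L x0 k = cuesa_x df h L x0 k"

primrec cuesa_v ::
  "(real ^ 'n \<Rightarrow> real ^ 'n) \<Rightarrow> (real ^ 'n \<Rightarrow> real) \<Rightarrow> real \<Rightarrow> real \<Rightarrow> real ^ 'n \<Rightarrow> nat \<Rightarrow> real ^ 'n" where
  "cuesa_v df h \<mu> L x0 0 = long_step df h \<mu> L x0"
| "cuesa_v df h \<mu> L x0 (Suc k) =
     (1 - cuesa_alpha \<mu> L k) *\<^sub>R cuesa_v df h \<mu> L x0 k +
     cuesa_alpha \<mu> L k *\<^sub>R long_step df h \<mu> L (cuesa_y df h L x0 k)"

primrec cuesa_phi ::
  "(real ^ 'n \<Rightarrow> real) \<Rightarrow> (real ^ 'n \<Rightarrow> real ^ 'n) \<Rightarrow> (real ^ 'n \<Rightarrow> real) \<Rightarrow> real \<Rightarrow> real \<Rightarrow>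
     real ^ 'n \<Rightarrow> nat \<Rightarrow> real" where
  "cuesa_phi F df h \<mu> L x0 0 =
     F (short_step df h L x0) +
     (1 / (2 * L) - 1 / (2 * \<mu>)) * (norm (grad_map df h L x0))\<^sup>2"
| "cuesa_phi F df h \<mu> L x0 (Suc k) =
     (let \<alpha> = cuesa_alpha \<mu> L k;
          y = cuesa_y df h L x0 k;
          v = cuesa_v df h \<mu> L x0 k;
          v' = cuesa_v df h \<mu> L x0 (Suc k)
      in (1 - \<alpha>) * (cuesa_phi F df h \<mu> L x0 k + \<mu> / 2 * (norm (v' - v))\<^sup>2) +
         \<alpha> * (F (short_step df h L y) +
              (1 / (2 * L) - 1 / (2 * \<mu>)) * (norm (grad_map df h L y))\<^sup>2 +
              \<mu> / 2 * (norm (v' - long_step df h \<mu> L y))\<^sup>2))"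

end

theory Submission
  imports Defs
begin

text \<open>
  Write \<open>\<alpha> = \<mu> / L\<close> and let \<open>G\<close> be the gradient map at \<open>x\<^sub>k\<close>. The rate follows from the
  one-step contraction
  \<open>F x\<^sub>k\<^sub>+\<^sub>1 - \<phi>\<^sub>k\<^sub>+\<^sub>1 \<le> (1 - \<alpha>) (F x\<^sub>k - \<phi>\<^sub>k)\<close>, and this is a balance of two effects.

  Since \<open>x\<^sub>k\<^sub>+\<^sub>1\<close> is the short step from \<open>y\<^sub>k = x\<^sub>k\<close>, dropping the nonnegative squares in the
  recursion for \<open>\<phi>\<close> gives
  \<open>F x\<^sub>k\<^sub>+\<^sub>1 - \<phi>\<^sub>k\<^sub>+\<^sub>1 \<le> (1 - \<alpha>) (F x\<^sub>k\<^sub>+\<^sub>1 - \<phi>\<^sub>k) + \<alpha> (1 / (2 \<mu>) - 1 / (2 L)) \<parallel>G\<parallel>\<^sup>2\<close>.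
  The proximal step decreases \<open>F\<close> by at least \<open>\<parallel>G\<parallel>\<^sup>2 / (2 L)\<close> (lemma
  \<open>short_step_sufficient_decrease\<close>), so the first term is at most
  \<open>(1 - \<alpha>) (F x\<^sub>k - \<phi>\<^sub>k) - (1 - \<alpha>) \<parallel>G\<parallel>\<^sup>2 / (2 L)\<close>.
  The choice \<open>\<alpha> = \<mu> / L\<close> makes \<open>\<alpha> (1 / (2 \<mu>) - 1 / (2 L))\<close> equal to \<open>(1 - \<alpha>) / (2 L)\<close>, and the two
  multiples of \<open>\<parallel>G\<parallel>\<^sup>2\<close> cancel exactly.

  The decrease rests on two facts about the proximal point: it exists, because a finite convex
  function falls at most linearly along rays and is therefore dominated by the quadratic term
  (lemma \<open>convex_plus_quadratic_has_minimizer\<close>); and the proximal objective, being strongly convex,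
  grows quadratically away from it (lemma \<open>minimizer_quadratic_growth\<close>). Comparing the
  proximal point with \<open>x\<close> itself and adding the smoothness bound on \<open>f\<close> yields the decrease.
\<close>

section \<open>Proximal points of convex functions\<close>

lemma norm_convex_combination_squared:
  fixes a b :: "'a::real_inner"
  shows "(norm ((1 - t) *\<^sub>R a + t *\<^sub>R b))\<^sup>2
    = (1 - t) * (norm a)\<^sup>2 + t * (norm b)\<^sup>2 - t * (1 - t) * (norm (a - b))\<^sup>2"
  by (simp add: power2_norm_eq_inner inner_add_left inner_add_right inner_diff_left
      inner_diff_right inner_commute) (simp add: algebra_simps power2_eq_square)

text \<open>
  Convexity on the segment from \<open>x\<close> to \<open>u\<close>, which meets the unit sphere around \<open>x\<close>, turns the
  lower bound on the unit ball into a linear lower bound everywhere outside it.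
\<close>

lemma convex_linear_lower_bound_outside_ball:
  fixes h :: "'a::real_normed_vector \<Rightarrow> real"
  assumes convex: "convex_on UNIV h"
    and bound: "\<And>w. w \<in> cball x 1 \<Longrightarrow> m \<le> h w"
    and far: "1 \<le> norm (u - x)"
  shows "h x - norm (u - x) * (h x - m) \<le> h u"
proof -
  define r where "r = norm (u - x)"
  define w where "w = x + (1 / r) *\<^sub>R (u - x)"
  have r: "1 \<le> r" using far by (simp add: r_def)
  have w_convex: "w = (1 - 1 / r) *\<^sub>R x + (1 / r) *\<^sub>R u"
    by (simp add: w_def algebra_simps)
  have "dist x w = 1"
    using r by (auto simp: w_def dist_norm r_def)
  then have "m \<le> h w" by (intro bound) simp
  also have "h w \<le> (1 - 1 / r) * h x + (1 / r) * h u"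
    unfolding w_convex using r by (intro convex_onD[OF convex]) auto
  finally have "r * m \<le> r * ((1 - 1 / r) * h x + (1 / r) * h u)"
    using r by (intro mult_left_mono) auto
  also have "\<dots> = (r - 1) * h x + h u"
    using r by (simp add: field_simps)
  finally have "r * m \<le> (r - 1) * h x + h u" .
  then show ?thesis by (simp add: r_def algebra_simps)
qed

text \<open>
  Beyond the radius \<open>2 (h x - m) / L\<close> the quadratic outweighs the linear descent of \<open>h\<close>, so no point
  there beats the centre \<open>x\<close>, and minimizing over the compact ball of that radius suffices.
\<close>

lemma convex_plus_quadratic_has_minimizer:
  fixes h :: "'a::euclidean_space \<Rightarrow> real"
  assumes convex: "convex_on UNIV h" and "0 < L"
  shows "\<exists>p. \<forall>u. h p + L / 2 * (norm (x - p))\<^sup>2 \<le> h u + L / 2 * (norm (x - u))\<^sup>2"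
proof -
  let ?obj = "\<lambda>u. h u + L / 2 * (norm (x - u))\<^sup>2"
  have h_continuous: "continuous_on S h" for S
    using convex_on_continuous[OF open_UNIV convex] continuous_on_subset by blast
  have obj_continuous: "continuous_on S ?obj" for S
    by (intro continuous_intros h_continuous)
  obtain q where q: "\<forall>w\<in>cball x 1. h q \<le> h w"
    using continuous_attains_inf[OF compact_cball _ h_continuous, of x 1] by auto
  define m where "m = h q"
  define R where "R = max 1 (2 * (h x - m) / L)"
  have "cball x R \<noteq> {}" unfolding R_def by auto
  then obtain p where p: "\<forall>u\<in>cball x R. ?obj p \<le> ?obj u"
    using continuous_attains_inf[OF compact_cball _ obj_continuous, of x R] by auto
  have "?obj p \<le> ?obj u" for u
  proof (cases "u \<in> cball x R")
    case True
    then show ?thesis using p by blast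
  next
    case False
    define r where "r = norm (u - x)"
    have "R < r" using False by (simp add: r_def dist_norm norm_minus_commute)
    then have r: "1 \<le> r" "2 * (h x - m) / L \<le> r" by (auto simp: R_def)
    have "h x - m \<le> L / 2 * r" using r(2) \<open>0 < L\<close> by (simp add: field_simps)
    then have "r * (h x - m) \<le> r * (L / 2 * r)" using r(1) by (intro mult_left_mono) auto
    then have "r * (h x - m) \<le> L / 2 * r\<^sup>2" by (simp add: power2_eq_square algebra_simps)
    moreover have "h x - r * (h x - m) \<le> h u"
      unfolding r_def using q r(1)
      by (intro convex_linear_lower_bound_outside_ball[OF convex]) (auto simp: m_def r_def)
    ultimately have "?obj x \<le> ?obj u" by (simp add: r_def norm_minus_commute)
    moreover have "x \<in> cball x R" by (simp add: R_def)
    then have "?obj p \<le> ?obj x" using p by blast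
    ultimately show ?thesis by linarith
  qed
  then show ?thesis by blast
qed

lemma prox_minimizes:
  fixes h :: "real ^ 'n \<Rightarrow> real"
  assumes "convex_on UNIV h" and "0 < L"
  shows "h (prox h L z) + L / 2 * (norm (z - prox h L z))\<^sup>2 \<le> h u + L / 2 * (norm (z - u))\<^sup>2"
proof -
  let ?obj = "\<lambda>u. h u + L / 2 * (norm (z - u))\<^sup>2"
  obtain p where "\<forall>u. ?obj p \<le> ?obj u"
    using convex_plus_quadratic_has_minimizer[OF assms] by blast
  then have "is_arg_min ?obj (\<lambda>_. True) p" by (simp add: is_arg_min_linorder)
  then have "is_arg_min ?obj (\<lambda>_. True) (prox h L z)"
    unfolding prox_def arg_min_def by (rule someI)
  then show ?thesis by (simp add: is_arg_min_linorder)
qed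

text \<open>
  Moving from the minimizer \<open>p\<close> a fraction \<open>t\<close> of the way to \<open>u\<close> cannot lower the objective, while
  the convexity of \<open>h\<close> and the parallelogram-type identity for the quadratic bound the
  value there by the interpolated one minus
  \<open>t (1 - t) L / 2 \<parallel>p - u\<parallel>\<^sup>2\<close>. Dividing by \<open>t\<close> and letting \<open>t\<close> tend to \<open>0\<close> leaves the full quadratic.
\<close>

lemma minimizer_quadratic_growth:
  fixes h :: "'a::real_inner \<Rightarrow> real"
  assumes convex: "convex_on UNIV h"
    and minimizer: "\<And>u. h p + L / 2 * (norm (z - p))\<^sup>2 \<le> h u + L / 2 * (norm (z - u))\<^sup>2"
  shows "h p + L / 2 * (norm (z - p))\<^sup>2 + L / 2 * (norm (p - u))\<^sup>2
    \<le> h u + L / 2 * (norm (z - u))\<^sup>2"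
proof -
  define gap where "gap = h u + L / 2 * (norm (z - u))\<^sup>2 - (h p + L / 2 * (norm (z - p))\<^sup>2)"
  have "L / 2 * (norm (p - u))\<^sup>2 \<le> gap"
  proof (rule field_le_mult_one_interval)
    fix s :: real
    assume s: "0 < s" "s < 1"
    define t where "t = 1 - s"
    have t: "0 < t" "t < 1" using s by (auto simp: t_def)
    define w where "w = (1 - t) *\<^sub>R p + t *\<^sub>R u"
    have "h w \<le> (1 - t) * h p + t * h u"
      unfolding w_def using t by (intro convex_onD[OF convex]) auto
    moreover have "(norm (z - w))\<^sup>2
        = (1 - t) * (norm (z - p))\<^sup>2 + t * (norm (z - u))\<^sup>2 - t * (1 - t) * (norm (p - u))\<^sup>2"
    proof -
      have "z - w = (1 - t) *\<^sub>R (z - p) + t *\<^sub>R (z - u)"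
        by (simp add: w_def algebra_simps)
      then show ?thesis
        using norm_convex_combination_squared[of t "z - p" "z - u"]
        by (simp add: norm_minus_commute)
    qed
    ultimately have "h w + L / 2 * (norm (z - w))\<^sup>2
        \<le> (1 - t) * h p + t * h u + L / 2 *
          ((1 - t) * (norm (z - p))\<^sup>2 + t * (norm (z - u))\<^sup>2 - t * (1 - t) * (norm (p - u))\<^sup>2)"
      by simp
    then have "h p + L / 2 * (norm (z - p))\<^sup>2
        \<le> (1 - t) * h p + t * h u + L / 2 *
          ((1 - t) * (norm (z - p))\<^sup>2 + t * (norm (z - u))\<^sup>2 - t * (1 - t) * (norm (p - u))\<^sup>2)"
      using minimizer[of w] by linarith
    then have "t * (s * (L / 2 * (norm (p - u))\<^sup>2)) \<le> t * gap"
      by (simp add: gap_def t_def algebra_simps diff_divide_distrib add_divide_distrib)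
    then show "s * (L / 2 * (norm (p - u))\<^sup>2) \<le> gap" using t by simp
  qed
  then show ?thesis by (simp add: gap_def)
qed

section \<open>Decrease along a proximal gradient step\<close>

lemma short_step_eq_prox:
  "L \<noteq> 0 \<Longrightarrow> short_step df h L x = prox h L (x - (1 / L) *\<^sub>R df x)"
  by (simp add: short_step_def grad_map_def)

text \<open>
  The quadratic growth of the proximal objective, evaluated at \<open>x\<close>, contributes
  \<open>- L \<parallel>x - p\<parallel>\<^sup>2\<close> plus a gradient term, where \<open>p\<close> is the new point. The smoothness bound contributes
  \<open>L / 2 \<parallel>x - p\<parallel>\<^sup>2\<close> and the opposite gradient term.
\<close>

lemma short_step_sufficient_decrease:
  fixes f h :: "real ^ 'n \<Rightarrow> real" and df :: "real ^ 'n \<Rightarrow> real ^ 'n"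
  assumes "0 < L" and convex: "convex_on UNIV h"
    and smooth: "\<And>u. f u \<le> f x + df x \<bullet> (u - x) + L / 2 * (norm (u - x))\<^sup>2"
  shows "f (short_step df h L x) + h (short_step df h L x)
    \<le> f x + h x - 1 / (2 * L) * (norm (grad_map df h L x))\<^sup>2"
proof -
  define p where "p = short_step df h L x"
  define z where "z = x - (1 / L) *\<^sub>R df x"
  have "p = prox h L z"
    using \<open>0 < L\<close> by (simp add: p_def z_def short_step_eq_prox)
  then have growth: "h p + L / 2 * (norm (z - p))\<^sup>2 + L / 2 * (norm (p - x))\<^sup>2
      \<le> h x + L / 2 * (norm (z - x))\<^sup>2"
    using minimizer_quadratic_growth[OF convex] prox_minimizes[OF convex \<open>0 < L\<close>] by blast
  have "z - p = (z - x) - (p - x)" by simp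
  then have "(norm (z - p))\<^sup>2 = (norm (z - x))\<^sup>2 - 2 * ((z - x) \<bullet> (p - x)) + (norm (p - x))\<^sup>2"
    by (simp only: power2_norm_eq_inner inner_diff_left inner_diff_right)
      (simp add: inner_commute)
  moreover have "L * ((z - x) \<bullet> (p - x)) = - (df x \<bullet> (p - x))"
    using \<open>0 < L\<close> by (simp add: z_def)
  ultimately have "L / 2 * (norm (z - p))\<^sup>2
      = L / 2 * (norm (z - x))\<^sup>2 + df x \<bullet> (p - x) + L / 2 * (norm (p - x))\<^sup>2"
    by (simp only: distrib_left right_diff_distrib)
  with growth have "h p + df x \<bullet> (p - x) + L * (norm (p - x))\<^sup>2 \<le> h x" by (simp add: add_divide_distrib)
  then have "f p + h p \<le> f x + h x - L / 2 * (norm (p - x))\<^sup>2"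
    using smooth[of p] by simp
  moreover have "norm (p - x) = norm (grad_map df h L x) / L"
    using \<open>0 < L\<close> by (simp add: p_def short_step_def)
  then have "L / 2 * (norm (p - x))\<^sup>2 = 1 / (2 * L) * (norm (grad_map df h L x))\<^sup>2"
    using \<open>0 < L\<close> by (simp add: power2_eq_square field_simps)
  ultimately show ?thesis by (simp add: p_def)
qed

section \<open>Linear convergence\<close>

lemma cuesa_x_Suc_eq_short_step:
  "cuesa_x df h L x0 (Suc k) = short_step df h L (cuesa_x df h L x0 k)"
  by (simp add: short_step_def)

lemma cuesa_phi_Suc_lower_bound:
  fixes x0 :: "real ^ 'n"
  assumes "0 < \<mu>" and "\<mu> \<le> L"
  shows "(1 - \<mu> / L) * cuesa_phi F df h \<mu> L x0 k
      + \<mu> / L * (F (cuesa_x df h L x0 (Suc k))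
        + (1 / (2 * L) - 1 / (2 * \<mu>)) * (norm (grad_map df h L (cuesa_x df h L x0 k)))\<^sup>2)
    \<le> cuesa_phi F df h \<mu> L x0 (Suc k)"
proof -
  have weights: "0 \<le> \<mu> / L" "0 \<le> 1 - \<mu> / L" using assms by auto
  have drop_square: "w * a \<le> w * (a + \<mu> / 2 * (norm d)\<^sup>2)"
    if "0 \<le> w" for w a :: real and d :: "real ^ 'n"
    using that \<open>0 < \<mu>\<close> by (intro mult_left_mono) auto
  show ?thesis
    unfolding cuesa_phi.simps Let_def cuesa_alpha_def cuesa_y_def cuesa_x_Suc_eq_short_step
    by (rule add_mono; rule drop_square[OF weights(2)] drop_square[OF weights(1)])
qed

lemma cuesa_gap_contraction:
  fixes f h F :: "real ^ 'n \<Rightarrow> real" and df :: "real ^ 'n \<Rightarrow> real ^ 'n"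
  assumes "0 < \<mu>" and "\<mu> \<le> L"
    and convex: "convex_on UNIV h"
    and smooth: "\<And>x y. f x \<le> f y + df y \<bullet> (x - y) + L / 2 * (norm (x - y))\<^sup>2"
    and F: "\<And>x. F x = f x + h x"
  shows "F (cuesa_x df h L x0 (Suc k)) - cuesa_phi F df h \<mu> L x0 (Suc k)
    \<le> (1 - \<mu> / L) * (F (cuesa_x df h L x0 k) - cuesa_phi F df h \<mu> L x0 k)"
proof -
  define \<alpha> where "\<alpha> = \<mu> / L"
  define G2 where "G2 = (norm (grad_map df h L (cuesa_x df h L x0 k)))\<^sup>2"
  define Fk where "Fk = F (cuesa_x df h L x0 k)"
  define Fk' where "Fk' = F (cuesa_x df h L x0 (Suc k))"
  define \<phi> where "\<phi> = cuesa_phi F df h \<mu> L x0 k"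
  have "0 < L" using assms by linarith
  have "0 \<le> 1 - \<alpha>" using \<open>\<mu> \<le> L\<close> \<open>0 < L\<close> by (simp add: \<alpha>_def)
  have "Fk' \<le> Fk - 1 / (2 * L) * G2"
    unfolding Fk'_def Fk_def G2_def cuesa_x_Suc_eq_short_step F
    by (rule short_step_sufficient_decrease[OF \<open>0 < L\<close> convex smooth])
  then have decrease: "(1 - \<alpha>) * Fk' \<le> (1 - \<alpha>) * (Fk - 1 / (2 * L) * G2)"
    using \<open>0 \<le> 1 - \<alpha>\<close> by (rule mult_left_mono)
  have phi: "(1 - \<alpha>) * \<phi> + \<alpha> * (Fk' + (1 / (2 * L) - 1 / (2 * \<mu>)) * G2)
      \<le> cuesa_phi F df h \<mu> L x0 (Suc k)"
    using cuesa_phi_Suc_lower_bound[OF assms(1,2)]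
    by (simp only: \<alpha>_def \<phi>_def Fk'_def G2_def)
  \<comment> \<open>The value \<open>\<alpha> = \<mu> / L\<close> is exactly the one for which the loss in the model balances the
      guaranteed decrease.\<close>
  have "\<alpha> * (1 / (2 * L) - 1 / (2 * \<mu>)) = - ((1 - \<alpha>) * (1 / (2 * L)))"
    using \<open>0 < \<mu>\<close> \<open>0 < L\<close> by (simp add: \<alpha>_def field_simps)
  then have "\<alpha> * (Fk' + (1 / (2 * L) - 1 / (2 * \<mu>)) * G2)
      = \<alpha> * Fk' - (1 - \<alpha>) * (1 / (2 * L) * G2)"
    by (simp only: distrib_left mult.assoc[symmetric]) simp
  moreover have "(1 - \<alpha>) * (Fk - 1 / (2 * L) * G2) = (1 - \<alpha>) * Fk - (1 - \<alpha>) * (1 / (2 * L) * G2)"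
    by (rule right_diff_distrib)
  moreover have "Fk' = (1 - \<alpha>) * Fk' + \<alpha> * Fk'" by (simp add: algebra_simps)
  ultimately have "Fk' - cuesa_phi F df h \<mu> L x0 (Suc k) \<le> (1 - \<alpha>) * Fk - (1 - \<alpha>) * \<phi>"
    using decrease phi by linarith
  then show ?thesis
    by (simp only: Fk'_def Fk_def \<phi>_def \<alpha>_def right_diff_distrib)
qed

theorem corollary1:
  fixes f h F :: "real ^ 'n \<Rightarrow> real"
    and df :: "real ^ 'n \<Rightarrow> real ^ 'n"
    and \<mu> L :: real
    and x0 :: "real ^ 'n"
    and k :: nat
  assumes "0 < \<mu>" and "\<mu> \<le> L"
    and convex: "convex_on UNIV h"
    and gradient: "\<And>x. GDERIV f x :> df x"
    and gradient_continuous: "continuous_on UNIV df"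
    and strongly_convex:
      "\<And>x y. f x \<ge> f y + df y \<bullet> (x - y) + \<mu> / 2 * (norm (x - y))\<^sup>2"
    and smooth:
      "\<And>x y. f x \<le> f y + df y \<bullet> (x - y) + L / 2 * (norm (x - y))\<^sup>2"
    and F: "\<And>x. F x = f x + h x"
  shows "F (cuesa_x df h L x0 k) - cuesa_phi F df h \<mu> L x0 k
       \<le> (1 - \<mu> / L) ^ k * (F x0 - cuesa_phi F df h \<mu> L x0 0)"
proof (induction k)
  case 0
  show ?case by simp
next
  case (Suc k)
  have "0 \<le> 1 - \<mu> / L" using assms(1,2) by simp
  have "F (cuesa_x df h L x0 (Suc k)) - cuesa_phi F df h \<mu> L x0 (Suc k)
      \<le> (1 - \<mu> / L) * (F (cuesa_x df h L x0 k) - cuesa_phi F df h \<mu> L x0 k)"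
    by (rule cuesa_gap_contraction[OF assms(1,2) convex smooth F])
  also have "\<dots> \<le> (1 - \<mu> / L) * ((1 - \<mu> / L) ^ k * (F x0 - cuesa_phi F df h \<mu> L x0 0))"
    using Suc.IH \<open>0 \<le> 1 - \<mu> / L\<close> by (rule mult_left_mono)
  finally show ?case by (simp only: power_Suc mult.assoc)
qed

end
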